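(* Let $p\ge 1$ be an integer, let $0<\alpha\le 1$, and let $F\subseteq\mathbb{R}^p$ be a bounded (Lebesgue) measurable set. Then $$D_*(\alpha,F)\le \max\{0,\overline{\dim}_B(F)-1\}.$$
   Context: A function $f:F\to\mathbb{R}$ is $1$-Hölder-$\alpha$ if $|f(x)-f(y)|\le |x-y|^\alpha$ for all $x,y\in F$. $C_1^\alpha(F)$ denotes the set of all $1$-Hölder-$\alpha$ functions on $F$, equipped with the metric of the supremum norm $\|f\|_\infty=\sup_{x\in F}|f(x)|$. $\lambda$ is one-dimensional Lebesgue measure and $\dim_H$ is Hausdorff dimension (with $\dim_H\emptyset=\inf\{s\ge 0:\mathcal H^s(\emptyset)=0\}=0$). For $f:F\to\mathbb{R}$ and $r\in\mathbb{R}$ put $D^f(r,F)=\dim_H(f^{-1}(r))$ and $$D_*^f(F)=\sup\{d:\lambda\{r: D^f(r,F)\ge d\}>0\}.$$ Let $\mathfrak{G}_{1,\alpha}(F)$ be the family of all dense $G_\delta$ subsets of $C_1^\alpha(F)$, and set $$D_*(\alpha,F)=\sup_{\mathcal{G}\in\mathfrak{G}_{1,\alpha}(F)}\inf\{D_*^f(F): f\in\mathcal{G}\}.$$ The upper box dimension of a non-empty set $F\subseteq\mathbb{R}^p$ is $\overline{\dim}_B F=\limsup_{N\to\infty}\frac{\log a_N(F)}{N\log 2}$, where $a_N(F)$ is the number of closed $2^{-N}$ grid hypercubes intersected by $F$; $\overline{\dim}_B\emptyset=0$. *)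

theory Defs
  imports "HOL-Analysis.Analysis"
begin

(* |U|^s with the conventions |{}|^s = 0 and |U|^0 = 1 for nonempty U, so that H^0 is
   counting measure.  The case s = 0 is separate because 0 powr 0 = 0 in HOL. *)
definition diam_pow :: "real \<Rightarrow> 'a::metric_space set \<Rightarrow> real" where
  "diam_pow s U = (if U = {} then 0 else if s = 0 then 1 else diameter U powr s)"

(* Boundedness is required explicitly since diameter is unspecified on unbounded sets.
   Finite covers are included: the U i may be empty. *)
definition hausdorff_delta :: "real \<Rightarrow> real \<Rightarrow> 'a::metric_space set \<Rightarrow> ennreal" where
  "hausdorff_delta s \<delta> A =
     Inf {(\<Sum>i. ennreal (diam_pow s (U i))) | U :: nat \<Rightarrow> 'a set.
            A \<subseteq> (\<Union>i. U i) \<and> (\<forall>i. bounded (U i) \<and> diameter (U i) \<le> \<delta>)}"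

(* hausdorff_delta increases as delta decreases, so the limit delta -> 0 is a supremum. *)
definition hausdorff_measure :: "real \<Rightarrow> 'a::metric_space set \<Rightarrow> ennreal" where
  "hausdorff_measure s A = (SUP \<delta>\<in>{0<..}. hausdorff_delta s \<delta> A)"

definition hausdorff_dim :: "'a::metric_space set \<Rightarrow> ereal" where
  "hausdorff_dim A = Inf {ereal s | s. 0 \<le> s \<and> hausdorff_measure s A = 0}"

definition grid_cube :: "nat \<Rightarrow> int ^ 'n \<Rightarrow> (real ^ 'n) set" where
  "grid_cube N k = cbox (\<chi> i. of_int (k $ i) / 2 ^ N) (\<chi> i. (of_int (k $ i) + 1) / 2 ^ N)"

(* Only meaningful for bounded F: for unbounded F the set is infinite and card gives 0. *)
definition grid_count :: "nat \<Rightarrow> (real ^ 'n) set \<Rightarrow> nat" where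
  "grid_count N F = card {Q \<in> range (grid_cube N). Q \<inter> F \<noteq> {}}"

definition upper_box_dim :: "(real ^ 'n) set \<Rightarrow> ereal" where
  "upper_box_dim F =
     (if F = {} then 0
      else limsup (\<lambda>N. ereal (ln (real (grid_count N F)) / (real N * ln 2))))"

(* Functions F -> R are represented by extensional functions (undefined outside F). *)
definition holder1 :: "real \<Rightarrow> 'a::metric_space set \<Rightarrow> ('a \<Rightarrow> real) set" where
  "holder1 \<alpha> F = {f \<in> extensional F. \<forall>x\<in>F. \<forall>y\<in>F. \<bar>f x - f y\<bar> \<le> dist x y powr \<alpha>}"

(* The metric of funspace is the supremum metric on bounded functions.  For bounded F and
   0 \<le> \<alpha> every function in holder1 is bounded, so the carrier is all of holder1. *)
definition holder1_metric :: "real \<Rightarrow> 'a::metric_space set \<Rightarrow> ('a \<Rightarrow> real) metric" where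
  "holder1_metric \<alpha> F = submetric (funspace F euclidean_metric) (holder1 \<alpha> F)"

definition level_dim :: "('a::metric_space \<Rightarrow> real) \<Rightarrow> real \<Rightarrow> 'a set \<Rightarrow> ereal" where
  "level_dim f r F = hausdorff_dim {x \<in> F. f x = r}"

(* Outer measure, because measurability of the set of levels r is not clear when F is only
   Lebesgue measurable; it agrees with Lebesgue measure on measurable sets. *)
definition D_star_fun :: "('a::metric_space \<Rightarrow> real) \<Rightarrow> 'a set \<Rightarrow> ereal" where
  "D_star_fun f F =
     Sup {ereal d | d. outer_measure_of lebesgue {r. level_dim f r F \<ge> ereal d} > 0}"

definition dense_gdeltas :: "real \<Rightarrow> 'a::metric_space set \<Rightarrow> ('a \<Rightarrow> real) set set" where
  "dense_gdeltas \<alpha> F =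
     {G. gdelta_in (mtopology_of (holder1_metric \<alpha> F)) G \<and>
         mtopology_of (holder1_metric \<alpha> F) closure_of G = mspace (holder1_metric \<alpha> F)}"

definition D_star :: "real \<Rightarrow> 'a::metric_space set \<Rightarrow> ereal" where
  "D_star \<alpha> F = (SUP G\<in>dense_gdeltas \<alpha> F. INF f\<in>G. D_star_fun f F)"

end

theory Submission
  imports Defs
begin

text \<open>
  Fix \<open>s > 0\<close> with \<open>s + 1\<close> above the upper box dimension of \<open>F\<close>.  The infimum in the
  definition of \<open>D_star\<close> asks only for one good function in each dense \<open>G\<^sub>\<delta>\<close> set, so
  one may aim at this single \<open>s\<close> and let it decrease to the bound at the very end.

  If \<open>f\<close> is Lipschitz, each of the at most about \<open>2\<^sup>N\<^sup>u\<close> grid cubes of side \<open>2\<^sup>-\<^sup>N\<close> meeting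
  \<open>F\<close>, where \<open>u < s + 1\<close>, has an image of length \<open>O(2\<^sup>-\<^sup>N)\<close>.  Covering every level set by the
  cubes whose image contains the level, and integrating the resulting \<open>s\<close>-sums over all
  levels, gives \<open>O(2\<^sup>N\<^sup>u 2\<^sup>-\<^sup>N 2\<^sup>-\<^sup>N\<^sup>s)\<close>, which tends to \<open>0\<close>: this is Eilenberg's inequality for
  box dimension.  A perturbation of \<open>f\<close> by at most \<open>2\<^sup>-\<^sup>N\<close> in the supremum norm lengthens the
  images by \<open>O(2\<^sup>-\<^sup>N)\<close> only, so the same estimate at scale \<open>N\<close> holds on a whole ball around
  \<open>f\<close> (\<open>eventually_cover_cost_le_near_lipschitz\<close>).

  Lipschitz functions are dense among the \<open>1\<close>-Hoelder-\<open>\<alpha>\<close> functions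
  (\<open>holder1_lipschitz_approx\<close>), hence for every \<open>M\<close> the balls of radius \<open>2\<^sup>-\<^sup>N\<close>,
  \<open>N \<ge> M\<close>, on which the cost at scale \<open>N\<close> is at most \<open>2\<^sup>-\<^sup>M\<close> have a dense open union.  The space is complete, so by the Baire category
  theorem every dense \<open>G\<^sub>\<delta>\<close> set contains a function \<open>g\<close> that has small covering cost at
  infinitely many scales.  By Fatou's lemma almost every level set of \<open>g\<close> is
  then \<open>\<H>\<^sup>s\<close>-null (\<open>AE_hausdorff_measure_level_set_eq_0\<close>).
\<close>

section \<open>Finite covers and grid cubes\<close>

lemma diam_pow_le_powr:
  assumes "0 < s" "bounded U" "diameter U \<le> \<delta>"
  shows "diam_pow s U \<le> \<delta> powr s"
  using assms diameter_ge_0[OF assms(2)] by (auto simp: diam_pow_def intro: powr_mono2)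

text \<open>
  The finite cover is padded with empty sets, whose \<open>diam_pow\<close> is \<open>0\<close>.
\<close>
lemma hausdorff_delta_finite_cover_le:
  assumes "finite \<Q>" "A \<subseteq> \<Union>\<Q>" "0 < s" "0 \<le> \<delta>"
    and small: "\<And>Q. Q \<in> \<Q> \<Longrightarrow> bounded Q \<and> diameter Q \<le> \<delta>"
  shows "hausdorff_delta s \<delta> A \<le> of_nat (card \<Q>) * ennreal (\<delta> powr s)"
proof -
  obtain e where e: "bij_betw e {..<card \<Q>} \<Q>"
    using ex_bij_betw_nat_finite[OF assms(1)] atLeast0LessThan by metis
  define U where "U i = (if i < card \<Q> then e i else {})" for i
  have UQ: "U i \<in> insert {} \<Q>" for i
    using e by (auto simp: U_def bij_betw_def)
  have "A \<subseteq> (\<Union>i. U i)"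
  proof
    fix x assume "x \<in> A"
    then obtain Q where Q: "Q \<in> \<Q>" "x \<in> Q" using assms(2) by blast
    then obtain i where "i < card \<Q>" "e i = Q"
      using e unfolding bij_betw_def by (metis imageE lessThan_iff)
    with Q show "x \<in> (\<Union>i. U i)" by (auto simp: U_def intro!: exI[of _ i])
  qed
  moreover have "bounded (U i) \<and> diameter (U i) \<le> \<delta>" for i
    using UQ[of i] small \<open>0 \<le> \<delta>\<close> by auto
  ultimately have "hausdorff_delta s \<delta> A \<le> (\<Sum>i. ennreal (diam_pow s (U i)))"
    unfolding hausdorff_delta_def by (intro Inf_lower) blast
  also have "\<dots> = (\<Sum>i<card \<Q>. ennreal (diam_pow s (U i)))"
    by (intro suminf_finite) (auto simp: U_def diam_pow_def)
  also have "\<dots> \<le> (\<Sum>i<card \<Q>. ennreal (\<delta> powr s))"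
    using \<open>\<And>i. bounded (U i) \<and> diameter (U i) \<le> \<delta>\<close> \<open>0 < s\<close>
    by (intro sum_mono ennreal_leI diam_pow_le_powr) auto
  finally show ?thesis by simp
qed

lemma hausdorff_delta_antimono:
  "\<delta> \<le> \<epsilon> \<Longrightarrow> hausdorff_delta s \<epsilon> A \<le> hausdorff_delta s \<delta> A"
  unfolding hausdorff_delta_def by (intro Inf_superset_mono) (blast intro: order_trans)

lemma diameter_grid_cube:
  "diameter (grid_cube N (k :: int ^ 'n)) \<le> real CARD('n) / 2 ^ N"
proof (rule diameter_le)
  fix x y assume xy: "x \<in> grid_cube N k" "y \<in> grid_cube N k"
  have "\<bar>(x - y) $ i\<bar> \<le> 1 / 2 ^ N" for i
  proof -
    have "of_int (k $ i) / 2 ^ N \<le> x $ i" "x $ i \<le> (of_int (k $ i) + 1) / 2 ^ N"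
      "of_int (k $ i) / 2 ^ N \<le> y $ i" "y $ i \<le> (of_int (k $ i) + 1) / 2 ^ N"
      using xy by (auto simp: grid_cube_def mem_box_cart)
    then show ?thesis by (auto simp: add_divide_distrib abs_le_iff)
  qed
  then have "(\<Sum>i\<in>UNIV. \<bar>(x - y) $ i\<bar>) \<le> (\<Sum>i\<in>(UNIV::'n set). 1 / 2 ^ N)"
    by (intro sum_mono)
  then show "norm (x - y) \<le> real CARD('n) / 2 ^ N"
    using norm_le_l1_cart[of "x - y"] by simp
qed simp

lemma bounded_grid_cube: "bounded (grid_cube N k)"
  by (simp add: grid_cube_def bounded_cbox)

lemma ex_grid_cube: "\<exists>k. x \<in> grid_cube N k"
proof
  show "x \<in> grid_cube N (\<chi> i. \<lfloor>x $ i * 2 ^ N\<rfloor>)"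
    by (auto simp: grid_cube_def mem_box_cart field_simps) linarith
qed

lemma finite_grid_cubes_meeting:
  fixes F :: "(real ^ 'n) set"
  assumes "bounded F"
  shows "finite {Q \<in> range (grid_cube N). Q \<inter> F \<noteq> {}}"
proof -
  obtain B where B: "\<And>x. x \<in> F \<Longrightarrow> norm x \<le> B"
    using assms bounded_iff by blast
  \<comment> \<open>The extra 1 accounts for a cube whose lower corner lies outside the range of \<open>F\<close>.\<close>
  define b where "b = \<lceil>B * 2 ^ N\<rceil> + 1"
  define K where "K = {k :: int ^ 'n. \<forall>i. k $ i \<in> {-b..b}}"
  have "K \<subseteq> vec_lambda ` (UNIV \<rightarrow>\<^sub>E {-b..b})"
  proof
    fix k assume "k \<in> K"
    then have "vec_nth k \<in> UNIV \<rightarrow>\<^sub>E {-b..b}" by (auto simp: K_def PiE_def)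
    then show "k \<in> vec_lambda ` (UNIV \<rightarrow>\<^sub>E {-b..b})"
      by (metis image_eqI vec_nth_inverse)
  qed
  then have "finite K"
    by (rule finite_subset) (intro finite_imageI finite_PiE, auto)
  moreover have "{Q \<in> range (grid_cube N). Q \<inter> F \<noteq> {}} \<subseteq> grid_cube N ` K"
  proof
    fix Q assume "Q \<in> {Q \<in> range (grid_cube N). Q \<inter> F \<noteq> {}}"
    then obtain k x where Q: "Q = grid_cube N k" and x: "x \<in> grid_cube N k" "x \<in> F" by blast
    have "k $ i \<in> {-b..b}" for i
    proof -
      have "of_int (k $ i) / 2 ^ N \<le> x $ i" "x $ i \<le> (of_int (k $ i) + 1) / 2 ^ N"
        using x(1) by (auto simp: grid_cube_def mem_box_cart)
      then have "of_int (k $ i) \<le> x $ i * 2 ^ N" "x $ i * 2 ^ N \<le> of_int (k $ i) + 1"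
        by (auto simp: field_simps)
      moreover have "\<bar>x $ i * 2 ^ N\<bar> \<le> B * 2 ^ N"
        using component_le_norm_cart[of x i] B[OF x(2)] by (simp add: abs_mult)
      moreover have "B * 2 ^ N \<le> of_int (b - 1)" by (simp add: b_def)
      ultimately have "of_int (k $ i) \<le> (of_int b :: real)" "- of_int b \<le> (of_int (k $ i) :: real)"
        by auto
      then show ?thesis by (simp flip: of_int_minus)
    qed
    then show "Q \<in> grid_cube N ` K" by (auto simp: K_def Q)
  qed
  ultimately show ?thesis by (meson finite_imageI finite_subset)
qed

section \<open>Level sets and the cost of grid covers\<close>

text \<open>
  The number \<open>w\<close> bounds the oscillation of \<open>g\<close> on the cubes, so the images of the cubes lie in
  intervals of length \<open>2 * w\<close>; since \<open>CARD('n) / 2 ^ N\<close> dominates the diameter of a cube, the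
  product on the left of \<open>\<eta>\<close> dominates the integral over \<open>r\<close> of the \<open>s\<close>-sum of the cubes that
  cover the level set of \<open>r\<close>.  Quantifying over upper bounds \<open>w\<close>
  avoids suprema over cubes that miss \<open>F\<close>.
\<close>
definition cover_cost_le :: "(real ^ 'n) set \<Rightarrow> real \<Rightarrow> nat \<Rightarrow> ((real ^ 'n) \<Rightarrow> real) \<Rightarrow> real \<Rightarrow> bool" where
  "cover_cost_le F s N g \<eta> \<longleftrightarrow> (\<exists>w\<ge>0.
     (\<forall>k. \<forall>x \<in> grid_cube N k \<inter> F. \<forall>y \<in> grid_cube N k \<inter> F. \<bar>g x - g y\<bar> \<le> w) \<and>
     real (grid_count N F) * (2 * w) * (real CARD('n) / 2 ^ N) powr s \<le> \<eta>)"

text \<open>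
  The level set of \<open>r\<close> is covered by those cubes \<open>Q\<close> for which \<open>r\<close> lies in a fixed interval
  containing the image of \<open>Q\<close>.  Using intervals rather than the images themselves, which may be
  non-measurable, makes the resulting bound a Borel function of \<open>r\<close>, and exchanging the sum over
  cubes with the integral over \<open>r\<close> yields the cost.
\<close>
lemma cover_cost_le_integral:
  fixes F :: "(real ^ 'n) set"
  assumes "bounded F" "0 < s" "cover_cost_le F s N g \<eta>"
  obtains h :: "real \<Rightarrow> ennreal" where "h \<in> borel_measurable lborel"
    "(\<integral>\<^sup>+ r. h r \<partial>lborel) \<le> ennreal \<eta>"
    "\<And>r. hausdorff_delta s (real CARD('n) / 2 ^ N) {x \<in> F. g x = r} \<le> h r"
proof -
  define \<delta> where "\<delta> = real CARD('n) / 2 ^ N"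
  define \<Q> where "\<Q> = {Q \<in> range (grid_cube N). Q \<inter> F \<noteq> {}}"
  obtain w where "0 \<le> w"
    and w: "\<And>Q x y. Q \<in> \<Q> \<Longrightarrow> x \<in> Q \<inter> F \<Longrightarrow> y \<in> Q \<inter> F \<Longrightarrow> \<bar>g x - g y\<bar> \<le> w"
    and cost: "real (card \<Q>) * (2 * w) * \<delta> powr s \<le> \<eta>"
    using assms(3) unfolding cover_cost_le_def \<Q>_def \<delta>_def grid_count_def by blast
  have fin: "finite \<Q>"
    unfolding \<Q>_def by (rule finite_grid_cubes_meeting[OF assms(1)])
  have "\<forall>Q\<in>\<Q>. \<exists>x. x \<in> Q \<inter> F" by (auto simp: \<Q>_def)
  then obtain p where p: "\<And>Q. Q \<in> \<Q> \<Longrightarrow> p Q \<in> Q \<inter> F" by metis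
  define J where "J Q = {g (p Q) - w..g (p Q) + w}" for Q
  define h where "h r = (\<Sum>Q\<in>\<Q>. ennreal (\<delta> powr s) * indicator (J Q) r)" for r
  show ?thesis
  proof
    show "h \<in> borel_measurable lborel"
      unfolding h_def J_def by measurable
    have "(\<integral>\<^sup>+ r. h r \<partial>lborel) = (\<Sum>Q\<in>\<Q>. ennreal (\<delta> powr s) * emeasure lborel (J Q))"
      unfolding h_def J_def by (simp add: nn_integral_sum nn_integral_cmult)
    also have "\<dots> = of_nat (card \<Q>) * (ennreal (\<delta> powr s) * ennreal (2 * w))"
      using \<open>0 \<le> w\<close> by (simp add: J_def)
    also have "\<dots> = ennreal (real (card \<Q>) * (2 * w) * \<delta> powr s)"
      using \<open>0 \<le> w\<close> by (simp add: ennreal_mult ennreal_of_nat_eq_real_of_nat mult_ac)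
    finally show "(\<integral>\<^sup>+ r. h r \<partial>lborel) \<le> ennreal \<eta>"
      using cost by (simp add: ennreal_leI)
    fix r
    define \<R> where "\<R> = {Q \<in> \<Q>. r \<in> J Q}"
    have "{x \<in> F. g x = r} \<subseteq> \<Union>\<R>"
    proof clarify
      fix x assume x: "x \<in> F" "r = g x"
      obtain k where k: "x \<in> grid_cube N k" using ex_grid_cube by blast
      with x have Q: "grid_cube N k \<in> \<Q>" by (auto simp: \<Q>_def)
      have "\<bar>g x - g (p (grid_cube N k))\<bar> \<le> w" using w[OF Q _ p[OF Q]] x k by auto
      then have "grid_cube N k \<in> \<R>" using Q by (auto simp: \<R>_def J_def x(2))
      with k show "x \<in> \<Union>\<R>" by blast
    qed
    moreover have "bounded Q \<and> diameter Q \<le> \<delta>" if "Q \<in> \<R>" for Q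
      using that bounded_grid_cube diameter_grid_cube by (auto simp: \<R>_def \<Q>_def \<delta>_def)
    ultimately have "hausdorff_delta s \<delta> {x \<in> F. g x = r} \<le> of_nat (card \<R>) * ennreal (\<delta> powr s)"
      using fin assms(2) by (intro hausdorff_delta_finite_cover_le) (auto simp: \<R>_def \<delta>_def)
    also have "\<dots> = h r"
      using fin by (simp add: h_def \<R>_def indicator_def if_distrib sum.If_cases Int_def cong: if_cong)
    finally show "hausdorff_delta s (real CARD('n) / 2 ^ N) {x \<in> F. g x = r} \<le> h r"
      by (simp add: \<delta>_def)
  qed
qed

text \<open>
  Small cost along some sequence of scales suffices: by Fatou's lemma the lower limit of the
  cost densities vanishes almost everywhere, and for every \<open>\<epsilon> > 0\<close> the \<open>\<epsilon>\<close>-approximation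
  to the Hausdorff measure of a level set is at most this lower limit.
\<close>
lemma AE_hausdorff_measure_level_set_eq_0:
  fixes F :: "(real ^ 'n) set"
  assumes "bounded F" "0 < s"
    and cost: "\<And>M::nat. \<exists>N\<ge>M. cover_cost_le F s N g (1 / 2 ^ M)"
  shows "AE r in lborel. hausdorff_measure s {x \<in> F. g x = r} = 0"
proof -
  obtain N where N: "\<And>M. N M \<ge> M" "\<And>M. cover_cost_le F s (N M) g (1 / 2 ^ M)"
    using cost by metis
  define \<delta> where "\<delta> M = real CARD('n) / 2 ^ N M" for M
  have "\<forall>M. \<exists>h :: real \<Rightarrow> ennreal. h \<in> borel_measurable lborel \<and>
    (\<integral>\<^sup>+ r. h r \<partial>lborel) \<le> ennreal (1 / 2 ^ M) \<and>
    (\<forall>r. hausdorff_delta s (\<delta> M) {x \<in> F. g x = r} \<le> h r)"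
  proof
    fix M
    show "\<exists>h :: real \<Rightarrow> ennreal. h \<in> borel_measurable lborel \<and>
      (\<integral>\<^sup>+ r. h r \<partial>lborel) \<le> ennreal (1 / 2 ^ M) \<and>
      (\<forall>r. hausdorff_delta s (\<delta> M) {x \<in> F. g x = r} \<le> h r)"
      using cover_cost_le_integral[OF assms(1,2) N(2)[of M]] unfolding \<delta>_def by blast
  qed
  from choice[OF this] obtain h :: "nat \<Rightarrow> real \<Rightarrow> ennreal" where h: "\<And>M. h M \<in> borel_measurable lborel"
    "\<And>M. (\<integral>\<^sup>+ r. h M r \<partial>lborel) \<le> ennreal (1 / 2 ^ M)"
    "\<And>M r. hausdorff_delta s (\<delta> M) {x \<in> F. g x = r} \<le> h M r"
    by blast
  have half: "(\<lambda>M. 1 / 2 ^ M :: real) \<longlonglongrightarrow> 0"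
    using LIMSEQ_realpow_zero[of "1/2"] by (simp add: power_one_over)
  have "(\<integral>\<^sup>+ r. liminf (\<lambda>M. h M r) \<partial>lborel) \<le> liminf (\<lambda>M. \<integral>\<^sup>+ r. h M r \<partial>lborel)"
    by (rule nn_integral_liminf) (rule h)
  also have "\<dots> \<le> liminf (\<lambda>M. ennreal (1 / 2 ^ M))"
    by (intro Liminf_mono always_eventually allI h)
  also have "\<dots> = 0"
    using tendsto_ennrealI[OF half] by (intro lim_imp_Liminf) auto
  finally have "(\<integral>\<^sup>+ r. liminf (\<lambda>M. h M r) \<partial>lborel) = 0" by simp
  moreover have "(\<lambda>r. liminf (\<lambda>M. h M r)) \<in> borel_measurable lborel"
    using h(1) by measurable
  ultimately have "AE r in lborel. liminf (\<lambda>M. h M r) = 0"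
    by (simp add: nn_integral_0_iff_AE)
  then show ?thesis
  proof eventually_elim
    case (elim r)
    have "hausdorff_delta s \<epsilon> {x \<in> F. g x = r} = 0" if "0 < \<epsilon>" for \<epsilon>
    proof -
      have "eventually (\<lambda>M. real CARD('n) * (1 / 2 ^ M) < \<epsilon>) sequentially"
        using order_tendstoD(2)[OF tendsto_mult_right_zero[OF half] that] .
      then have "eventually (\<lambda>M. hausdorff_delta s \<epsilon> {x \<in> F. g x = r} \<le> h M r) sequentially"
      proof eventually_elim
        case (elim M)
        have "\<delta> M \<le> real CARD('n) * (1 / 2 ^ M)"
          using N(1)[of M] by (auto simp: \<delta>_def intro!: divide_left_mono power_increasing)
        with elim have "\<delta> M \<le> \<epsilon>" by simp
        then show ?case using hausdorff_delta_antimono h(3) order_trans by blast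
      qed
      then have "hausdorff_delta s \<epsilon> {x \<in> F. g x = r} \<le> liminf (\<lambda>M. h M r)"
        by (rule Liminf_bounded)
      with elim show ?thesis by simp
    qed
    then show ?case by (simp add: hausdorff_measure_def)
  qed
qed

text \<open>
  A set of levels that could witness a value \<open>d > s\<close> lies in the exceptional null set, and
  therefore has outer measure zero.
\<close>
lemma D_star_fun_le:
  assumes "0 \<le> s" and ae: "AE r in lborel. hausdorff_measure s {x \<in> F. f x = r} = 0"
  shows "D_star_fun f F \<le> ereal s"
  unfolding D_star_fun_def
proof (rule Sup_least, clarify)
  fix d assume pos: "outer_measure_of lebesgue {r. level_dim f r F \<ge> ereal d} > 0"
  show "ereal d \<le> ereal s"
  proof (rule ccontr)
    assume "\<not> ereal d \<le> ereal s"
    obtain Z where Z: "Z \<in> null_sets lborel"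
      "\<And>r. r \<notin> Z \<Longrightarrow> hausdorff_measure s {x \<in> F. f x = r} = 0"
      using AE_E3[OF ae] by auto
    have "{r. level_dim f r F \<ge> ereal d} \<subseteq> Z"
    proof (rule ccontr)
      assume "\<not> {r. level_dim f r F \<ge> ereal d} \<subseteq> Z"
      then obtain r where r: "ereal d \<le> level_dim f r F" "r \<notin> Z" by blast
      have "level_dim f r F \<le> ereal s"
        unfolding level_dim_def hausdorff_dim_def using Z(2)[OF r(2)] \<open>0 \<le> s\<close>
        by (intro Inf_lower) auto
      with r(1) \<open>\<not> ereal d \<le> ereal s\<close> show False by (auto dest: order_trans)
    qed
    then have "outer_measure_of lebesgue {r. level_dim f r F \<ge> ereal d} \<le> emeasure lebesgue Z"
      using outer_measure_of_mono[of _ Z lebesgue] null_sets_completionI[OF Z(1)]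
      by (auto simp: null_setsD2)
    also have "\<dots> = 0" using null_sets_completionI[OF Z(1)] by (rule null_setsD1)
    finally show False using pos by simp
  qed
qed

section \<open>Lipschitz approximation of Hoelder functions\<close>

text \<open>
  A modulus of continuity under which a function is both \<open>K\<close>-Lipschitz and \<open>1\<close>-Hoelder-\<open>\<alpha>\<close>.
\<close>
definition lip_holder_modulus :: "real \<Rightarrow> real \<Rightarrow> real \<Rightarrow> real" where
  "lip_holder_modulus K \<alpha> t = min (K * t) (t powr \<alpha>)"

text \<open>
  A function \<open>t * q t\<close> on the nonnegative reals with \<open>q\<close> nonincreasing is subadditive, because
  \<open>(a + b) * q (a + b) \<le> a * q a + b * q b\<close>.  Here \<open>q t\<close> is the minimum of \<open>K\<close> and
  \<open>t powr (\<alpha> - 1)\<close>, and \<open>\<alpha> \<le> 1\<close> makes it nonincreasing.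
\<close>
lemma lip_holder_modulus_subadditive:
  assumes "0 < \<alpha>" "\<alpha> \<le> 1" "0 \<le> K" "0 \<le> a" "0 \<le> b"
  shows "lip_holder_modulus K \<alpha> (a + b) \<le> lip_holder_modulus K \<alpha> a + lip_holder_modulus K \<alpha> b"
proof -
  define q where "q t = min K (t powr (\<alpha> - 1))" for t
  have factor: "lip_holder_modulus K \<alpha> t = t * q t" if "0 \<le> t" for t
  proof (cases "t = 0")
    case False
    then have "t * t powr (\<alpha> - 1) = t powr \<alpha>" using that by (simp add: powr_diff)
    with that show ?thesis
      by (simp add: lip_holder_modulus_def q_def min_mult_distrib_left mult.commute)
  qed (use assms in \<open>simp add: lip_holder_modulus_def\<close>)
  have "c * q (a + b) \<le> c * q c" if "0 \<le> c" "c \<le> a + b" for c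
  proof (cases "c = 0")
    case False
    have "(a + b) powr (\<alpha> - 1) \<le> c powr (\<alpha> - 1)"
      using that False assms by (intro powr_mono2') auto
    then show ?thesis using that by (intro mult_left_mono) (auto simp: q_def)
  qed simp
  from this[of a] this[of b] show ?thesis
    using assms by (simp add: factor distrib_right)
qed

lemma lip_holder_modulus_mono:
  assumes "0 < \<alpha>" "0 \<le> K" "0 \<le> a" "a \<le> b"
  shows "lip_holder_modulus K \<alpha> a \<le> lip_holder_modulus K \<alpha> b"
  unfolding lip_holder_modulus_def using assms by (intro min.mono mult_left_mono powr_mono2) auto

text \<open>
  The approximation is the infimal convolution of \<open>f\<close> with the modulus \<open>\<phi>\<close> given by
  \<open>lip_holder_modulus K \<alpha>\<close>.  Since \<open>\<phi>\<close> is monotone and subadditive, \<open>\<phi> (dist x y)\<close> satisfies the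
  triangle inequality, and so the infimal convolution has modulus of continuity \<open>\<phi>\<close>.  It is at
  most \<open>f\<close>, and it drops below \<open>f\<close> by no more than the largest excess of \<open>t powr \<alpha>\<close> over
  \<open>\<phi> t\<close>, which is small when \<open>K\<close> is large.
\<close>
lemma holder1_lipschitz_approx:
  fixes F :: "'a::metric_space set"
  assumes \<alpha>: "0 < \<alpha>" "\<alpha> \<le> 1" and f: "f \<in> holder1 \<alpha> F" and "0 < \<epsilon>"
  obtains K g where "0 \<le> K" "g \<in> holder1 \<alpha> F" "\<And>x. x \<in> F \<Longrightarrow> \<bar>f x - g x\<bar> \<le> \<epsilon>"
    "\<And>x y. x \<in> F \<Longrightarrow> y \<in> F \<Longrightarrow> \<bar>g x - g y\<bar> \<le> K * dist x y"
proof -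
  \<comment> \<open>Chosen so that \<open>t powr \<alpha> \<le> \<epsilon>\<close> for \<open>t \<le> \<tau>\<close>, while \<open>t powr \<alpha> \<le> K * t\<close> for \<open>t \<ge> \<tau>\<close>.\<close>
  define \<tau> where "\<tau> = \<epsilon> powr (1 / \<alpha>)"
  define K where "K = \<tau> powr (\<alpha> - 1)"
  define \<phi> where "\<phi> = lip_holder_modulus K \<alpha>"
  have "0 < \<tau>" "0 \<le> K" using \<open>0 < \<epsilon>\<close> by (auto simp: \<tau>_def K_def)
  have \<phi>_close: "t powr \<alpha> \<le> \<phi> t + \<epsilon>" if "0 \<le> t" for t
  proof (cases "t \<le> \<tau>")
    case True
    then have "t powr \<alpha> \<le> \<tau> powr \<alpha>" using that \<alpha> by (intro powr_mono2) auto
    also have "\<dots> = \<epsilon>" using \<open>0 < \<epsilon>\<close> \<alpha> by (simp add: \<tau>_def powr_powr)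
    also have "0 \<le> \<phi> t" using that \<open>0 \<le> K\<close> by (auto simp: \<phi>_def lip_holder_modulus_def)
    ultimately show ?thesis by simp
  next
    case False
    then have "t powr (\<alpha> - 1) \<le> K"
      unfolding K_def using \<open>0 < \<tau>\<close> \<alpha> by (intro powr_mono2') auto
    then have "t * t powr (\<alpha> - 1) \<le> t * K" using that by (rule mult_left_mono)
    moreover have "t * t powr (\<alpha> - 1) = t powr \<alpha>"
      using False \<open>0 < \<tau>\<close> by (simp add: powr_diff)
    ultimately show ?thesis
      using \<open>0 < \<epsilon>\<close> by (simp add: \<phi>_def lip_holder_modulus_def mult.commute)
  qed
  have f_le: "f x - \<epsilon> \<le> f y + \<phi> (dist x y)" if "x \<in> F" "y \<in> F" for x y
  proof -
    have "\<bar>f x - f y\<bar> \<le> dist x y powr \<alpha>" using f that by (simp add: holder1_def)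
    with \<phi>_close[of "dist x y"] show ?thesis by simp
  qed
  define g where "g = restrict (\<lambda>x. INF y\<in>F. f y + \<phi> (dist x y)) F"
  have bdd: "bdd_below ((\<lambda>y. f y + \<phi> (dist x y)) ` F)" if "x \<in> F" for x
    using f_le[OF that] by (intro bdd_belowI2)
  have g_le: "g x \<le> f y + \<phi> (dist x y)" if "x \<in> F" "y \<in> F" for x y
    using that cINF_lower[OF bdd] by (simp add: g_def)
  have g_ge: "c \<le> g x" if "x \<in> F" "\<And>y. y \<in> F \<Longrightarrow> c \<le> f y + \<phi> (dist x y)" for x c
    using that by (auto simp: g_def intro: cINF_greatest)
  have "g x - \<phi> (dist x x') \<le> g x'" if "x \<in> F" "x' \<in> F" for x x'
  proof (rule g_ge[OF that(2)])
    fix y assume "y \<in> F"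
    have "\<phi> (dist x y) \<le> \<phi> (dist x x' + dist x' y)"
      unfolding \<phi>_def using \<alpha> \<open>0 \<le> K\<close> by (intro lip_holder_modulus_mono dist_triangle) auto
    also have "\<dots> \<le> \<phi> (dist x x') + \<phi> (dist x' y)"
      unfolding \<phi>_def using \<alpha> \<open>0 \<le> K\<close> by (intro lip_holder_modulus_subadditive) auto
    finally show "g x - \<phi> (dist x x') \<le> f y + \<phi> (dist x' y)"
      using g_le[OF that(1) \<open>y \<in> F\<close>] by simp
  qed
  then have g_mod: "\<bar>g x - g x'\<bar> \<le> \<phi> (dist x x')" if "x \<in> F" "x' \<in> F" for x x'
    using that by (fastforce simp: abs_le_iff dist_commute)
  show ?thesis
  proof
    show "g \<in> holder1 \<alpha> F"
      using g_mod unfolding holder1_def \<phi>_def lip_holder_modulus_def by (auto simp: g_def)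
    show "\<bar>g x - g y\<bar> \<le> K * dist x y" if "x \<in> F" "y \<in> F" for x y
      using g_mod[OF that] by (simp add: \<phi>_def lip_holder_modulus_def)
    show "\<bar>f x - g x\<bar> \<le> \<epsilon>" if "x \<in> F" for x
    proof -
      have "f x - \<epsilon> \<le> g x" using f_le that by (intro g_ge)
      moreover have "g x \<le> f x"
        using g_le[OF that that] \<alpha> by (simp add: \<phi>_def lip_holder_modulus_def)
      ultimately show ?thesis using \<open>0 < \<epsilon>\<close> by simp
    qed
  qed (fact \<open>0 \<le> K\<close>)
qed

section \<open>The cost near a Lipschitz function\<close>

lemma eventually_grid_count_le:
  assumes "upper_box_dim F < ereal u"
  shows "eventually (\<lambda>N. real (grid_count N F) \<le> (2 ^ N) powr u) sequentially"
proof (cases "F = {}")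
  case True
  then show ?thesis by (simp add: grid_count_def)
next
  case False
  then have "limsup (\<lambda>N. ereal (ln (real (grid_count N F)) / (real N * ln 2))) < ereal u"
    using assms by (simp add: upper_box_dim_def)
  from Limsup_lessD[OF this] eventually_gt_at_top[of 0] show ?thesis
  proof eventually_elim
    case (elim N)
    show ?case
    proof (cases "grid_count N F = 0")
      case False
      have "ln (real (grid_count N F)) < u * ln (2 ^ N)"
        using elim by (simp add: ln_realpow pos_divide_less_eq mult_ac)
      then have "exp (ln (real (grid_count N F))) \<le> exp (u * ln (2 ^ N))" by simp
      then show ?thesis using False by (simp add: powr_def)
    qed simp
  qed
qed

text \<open>
  A cube of diameter at most \<open>c / 2 ^ N\<close> has oscillation at most \<open>K * c / 2 ^ N\<close> under \<open>f\<close>, and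
  passing to \<open>g\<close> adds at most \<open>1 / 2 ^ N\<close> at each of the two points compared.  With at most
  \<open>(2 ^ N) powr u\<close> cubes, \<open>u < s + 1\<close>, the cost is bounded by a constant times
  \<open>(2 powr (u - s - 1)) ^ N\<close>.  The scale from which this is below \<open>\<eta>\<close> depends on \<open>f\<close> through \<open>K\<close>,
  but not on \<open>g\<close>.
\<close>
lemma eventually_cover_cost_le_near_lipschitz:
  fixes F :: "(real ^ 'n) set"
  assumes s: "upper_box_dim F < ereal (s + 1)" and "0 \<le> K" "0 < \<eta>"
    and lip: "\<And>x y. x \<in> F \<Longrightarrow> y \<in> F \<Longrightarrow> \<bar>f x - f y\<bar> \<le> K * dist x y"
  shows "eventually (\<lambda>N. \<forall>g. (\<forall>x\<in>F. \<bar>f x - g x\<bar> \<le> 1 / 2 ^ N) \<longrightarrow> cover_cost_le F s N g \<eta>)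
    sequentially"
proof -
  define c where "c = real CARD('n)"
  obtain u where u: "upper_box_dim F < ereal u" "u < s + 1"
    using ereal_dense2[OF s] by auto
  define C where "C = (2 * (K * c + 2)) * c powr s"
  have "(\<lambda>N. C * (2 powr (u - s - 1)) ^ N) \<longlonglongrightarrow> 0"
    using u(2) by (intro tendsto_mult_right_zero LIMSEQ_realpow_zero) (auto simp: powr_less_one)
  from eventually_grid_count_le[OF u(1)] order_tendstoD(2)[OF this \<open>0 < \<eta>\<close>]
  show ?thesis
  proof eventually_elim
    case (elim N)
    define w where "w = (K * c + 2) / 2 ^ N"
    show ?case
    proof (intro allI impI)
      fix g assume g: "\<forall>x\<in>F. \<bar>f x - g x\<bar> \<le> 1 / 2 ^ N"
      have "\<bar>g x - g y\<bar> \<le> w" if "x \<in> grid_cube N k \<inter> F" "y \<in> grid_cube N k \<inter> F" for k x y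
      proof -
        have "dist x y \<le> c / 2 ^ N"
          unfolding c_def using that diameter_grid_cube
          by (intro order_trans[OF diameter_bounded_bound[OF bounded_grid_cube]]) auto
        then have "K * dist x y \<le> K * (c / 2 ^ N)" using \<open>0 \<le> K\<close> by (rule mult_left_mono)
        then have "\<bar>f x - f y\<bar> \<le> K * c / 2 ^ N"
          using lip[of x y] that by simp
        moreover have "\<bar>f x - g x\<bar> \<le> 1 / 2 ^ N" "\<bar>f y - g y\<bar> \<le> 1 / 2 ^ N"
          using g that by auto
        moreover have "w = K * c / 2 ^ N + 1 / 2 ^ N + 1 / 2 ^ N"
          by (simp add: w_def field_simps)
        ultimately show ?thesis by linarith
      qed
      moreover have "0 \<le> w" using \<open>0 \<le> K\<close> by (simp add: w_def c_def)
      moreover have "real (grid_count N F) * (2 * w) * (c / 2 ^ N) powr s \<le> \<eta>"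
      proof -
        have "real (grid_count N F) * (2 * w) * (c / 2 ^ N) powr s
            \<le> (2 ^ N) powr u * (2 * w) * (c / 2 ^ N) powr s"
          using elim(1) \<open>0 \<le> w\<close> by (intro mult_right_mono) auto
        also have "\<dots> = C * ((2 ^ N) powr u / (2 ^ N) / (2 ^ N) powr s)"
          by (simp add: w_def C_def c_def powr_divide)
        also have "\<dots> = C * (2 ^ N) powr (u - s - 1)"
          by (simp add: powr_diff)
        also have "\<dots> = C * (2 powr (u - s - 1)) ^ N"
          by (simp add: powr_realpow[symmetric] powr_powr mult.commute)
        finally show ?thesis using elim(2) by simp
      qed
      ultimately show "cover_cost_le F s N g \<eta>"
        unfolding cover_cost_le_def c_def by blast
    qed
  qed
qed

section \<open>Category in the space of Hoelder functions\<close>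

text \<open>
  Hoelder functions on a bounded set are bounded, so the boundedness built into the function
  space excludes none of them.
\<close>
lemma mspace_holder1_metric:
  assumes "0 < \<alpha>" "bounded F"
  shows "mspace (holder1_metric \<alpha> F) = holder1 \<alpha> F"
proof -
  have "bounded (f ` F)" if "f \<in> holder1 \<alpha> F" for f
  proof (cases "F = {}")
    case False
    then obtain a where "a \<in> F" by blast
    obtain B where B: "\<And>x. x \<in> F \<Longrightarrow> dist a x \<le> B"
      using assms(2) bounded_any_center[of F a] by blast
    have "dist (f a) (f x) \<le> B powr \<alpha>" if "x \<in> F" for x
    proof -
      have "dist (f a) (f x) \<le> dist a x powr \<alpha>"
        using \<open>f \<in> holder1 \<alpha> F\<close> \<open>a \<in> F\<close> that by (simp add: holder1_def dist_real_def)
      also have "\<dots> \<le> B powr \<alpha>" using B[OF that] assms(1) by (intro powr_mono2) auto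
      finally show ?thesis .
    qed
    then show ?thesis by (auto simp: bounded_def)
  qed simp
  then show ?thesis
    by (auto simp: holder1_metric_def Met_TC.fspace_def holder1_def)
qed

lemma mdist_holder1_metric_le:
  assumes "f \<in> mspace (holder1_metric \<alpha> F)" "g \<in> mspace (holder1_metric \<alpha> F)" "0 \<le> a"
  shows "mdist (holder1_metric \<alpha> F) f g \<le> a \<longleftrightarrow> (\<forall>x\<in>F. \<bar>f x - g x\<bar> \<le> a)"
proof (cases "F = {}")
  case False
  with assms show ?thesis
    by (simp add: holder1_metric_def Met_TC.funspace_mdist_le dist_real_def)
qed (use assms in \<open>simp add: holder1_metric_def\<close>)

text \<open>
  The Hoelder condition involves two points at a time, hence is closed even under pointwise
  limits, and a closed subspace of the complete space of bounded functions is complete.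
\<close>
lemma mcomplete_holder1_metric: "mcomplete_of (holder1_metric \<alpha> F)"
proof -
  define S where "S = mspace (holder1_metric \<alpha> F)"
  interpret S: Submetric "Met_TC.fspace F :: ('a \<Rightarrow> real) set" "Met_TC.fdist F" S
    by (simp add: S_def holder1_metric_def Met_TC.Metric_space_funspace Submetric.intro Submetric_axioms_def)
  have complete: "S.mcomplete"
    using Met_TC.mcomplete_funspace[of F, where ?'a = real]
    by (simp add: mcomplete_of_def complete_UNIV euclidean_metric_def)
  have "f \<in> S" if "range \<sigma> \<subseteq> S" and lim: "limitin S.mtopology \<sigma> f sequentially" for \<sigma> f
  proof -
    have f: "f \<in> Met_TC.fspace F" using lim S.limitin_mspace by blast
    have conv: "(\<lambda>n. \<sigma> n x) \<longlonglongrightarrow> f x" if "x \<in> F" for x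
    proof (rule metric_LIMSEQ_I)
      fix e :: real assume "0 < e"
      then obtain n0 where "\<And>n. n \<ge> n0 \<Longrightarrow> \<sigma> n \<in> Met_TC.fspace F \<and> Met_TC.fdist F (\<sigma> n) f < e"
        using lim by (auto simp: S.limit_metric_sequentially)
      then have "dist (\<sigma> n x) (f x) < e" if "n \<ge> n0" for n
        using Met_TC.funspace_mdist_le[OF _ f, of "\<sigma> n" "Met_TC.fdist F (\<sigma> n) f"] \<open>x \<in> F\<close> that
        by fastforce
      then show "\<exists>n0. \<forall>n\<ge>n0. dist (\<sigma> n x) (f x) < e" by blast
    qed
    have "\<bar>f x - f y\<bar> \<le> dist x y powr \<alpha>" if "x \<in> F" "y \<in> F" for x y
    proof (rule tendsto_upperbound)
      show "(\<lambda>n. \<bar>\<sigma> n x - \<sigma> n y\<bar>) \<longlonglongrightarrow> \<bar>f x - f y\<bar>"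
        using conv that by (intro tendsto_intros)
      have "\<sigma> n \<in> S" for n using \<open>range \<sigma> \<subseteq> S\<close> by blast
      then show "\<forall>\<^sub>F n in sequentially. \<bar>\<sigma> n x - \<sigma> n y\<bar> \<le> dist x y powr \<alpha>"
        using that by (simp add: S_def holder1_metric_def holder1_def)
    qed simp
    then show "f \<in> S"
      using f by (auto simp: S_def holder1_metric_def holder1_def Met_TC.fspace_def)
  qed
  with complete have "S.sub.mcomplete"
    by (intro S.sequentially_closedin_mcomplete_imp_mcomplete) blast+
  then show ?thesis by (simp add: mcomplete_of_def S_def holder1_metric_def)
qed

text \<open>
  Both the open sets shrinking to \<open>G\<close> and the sets \<open>U n\<close> are dense and open, so the Baire
  category theorem applies to the two families together.
\<close>
lemma dense_gdelta_meets_residual: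
  assumes "mcomplete_of m" "mspace m \<noteq> {}"
    and G: "gdelta_in (mtopology_of m) G" "mtopology_of m closure_of G = mspace m"
    and U: "\<And>n::nat. openin (mtopology_of m) (U n)"
      "\<And>n. mtopology_of m closure_of (U n) = mspace m"
  obtains x where "x \<in> G" "\<And>n. x \<in> U n"
proof -
  obtain C :: "nat \<Rightarrow> 'a set" where C: "\<And>n. openin (mtopology_of m) (C n)" "\<Inter>(range C) = G"
    using G(1) unfolding gdelta_in_descending by blast
  interpret Metric_space "mspace m" "mdist m" by simp
  have "mtopology closure_of \<Inter>(range C \<union> range U) = mspace m"
  proof (rule metric_Baire_category)
    show "mcomplete" using assms(1) by (simp add: mcomplete_of_def)
    fix T assume T: "T \<in> range C \<union> range U"
    have "mtopology_of m closure_of (C n) = mspace m" for n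
    proof -
      have "mtopology_of m closure_of G \<subseteq> mtopology_of m closure_of (C n)"
        using C(2) by (intro closure_of_mono) blast
      with G(2) closure_of_subset_topspace[of "mtopology_of m" "C n"] show ?thesis by simp
    qed
    with T show "openin mtopology T \<and> mtopology closure_of T = mspace m"
      using C(1) U by (auto simp: mtopology_of_def)
  qed simp
  then have "\<Inter>(range C \<union> range U) \<noteq> {}" using assms(2) by (metis closure_of_empty)
  then obtain x where "x \<in> \<Inter>(range C \<union> range U)" by blast
  then show thesis using that[of x] C(2) by auto
qed

text \<open>
  The union of \<open>\<B> M\<close> is open, and it is dense since it contains every Lipschitz function in the
  space.  Its members need not be close to Lipschitz functions at all scales, only at one
  scale \<open>N \<ge> M\<close>, and this is what a function in a given dense \<open>G\<^sub>\<delta>\<close> set can achieve for all \<open>M\<close>.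
\<close>
lemma dense_gdelta_contains_null_levels:
  fixes F :: "(real ^ 'n) set"
  assumes \<alpha>: "0 < \<alpha>" "\<alpha> \<le> 1" and "bounded F"
    and s: "0 < s" "upper_box_dim F < ereal (s + 1)"
    and G: "G \<in> dense_gdeltas \<alpha> F"
  shows "\<exists>g\<in>G. AE r in lborel. hausdorff_measure s {x \<in> F. g x = r} = 0"
proof -
  define m where "m = holder1_metric \<alpha> F"
  have m: "mspace m = holder1 \<alpha> F"
    unfolding m_def by (rule mspace_holder1_metric) (use assms in auto)
  have dist_le: "mdist m f g \<le> a \<longleftrightarrow> (\<forall>x\<in>F. \<bar>f x - g x\<bar> \<le> a)"
    if "f \<in> holder1 \<alpha> F" "g \<in> holder1 \<alpha> F" "0 \<le> a" for f g a
    using mdist_holder1_metric_le[of f \<alpha> F g a] that m by (simp add: m_def)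
  interpret Metric_space "mspace m" "mdist m" by simp
  have top: "mtopology_of m = mtopology" by (simp add: mtopology_of_def)
  define \<B> where "\<B> M = {mball f (1 / 2 ^ N) | f N. M \<le> N \<and> f \<in> holder1 \<alpha> F \<and>
    (\<forall>g\<in>holder1 \<alpha> F. mdist m f g < 1 / 2 ^ N \<longrightarrow> cover_cost_le F s N g (1 / 2 ^ M))}" for M
  have cost: "\<exists>N\<ge>M. cover_cost_le F s N g (1 / 2 ^ M)" if "g \<in> \<Union>(\<B> M)" for g M
    using that by (auto simp: \<B>_def m[symmetric])
  have dense: "mtopology closure_of \<Union>(\<B> M) = mspace m" for M
  proof -
    have "\<exists>g\<in>\<Union>(\<B> M). g \<in> mball f \<epsilon>" if f: "f \<in> mspace m" and "0 < \<epsilon>" for f \<epsilon>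
    proof -
      obtain K g where g: "0 \<le> K" "g \<in> holder1 \<alpha> F" "\<And>x. x \<in> F \<Longrightarrow> \<bar>f x - g x\<bar> \<le> \<epsilon> / 2"
        "\<And>x y. x \<in> F \<Longrightarrow> y \<in> F \<Longrightarrow> \<bar>g x - g y\<bar> \<le> K * dist x y"
        using holder1_lipschitz_approx[OF \<alpha>, of f F "\<epsilon> / 2"] f m \<open>0 < \<epsilon>\<close> by auto
      have "eventually (\<lambda>N. M \<le> N \<and> (\<forall>h. (\<forall>x\<in>F. \<bar>g x - h x\<bar> \<le> 1 / 2 ^ N) \<longrightarrow>
          cover_cost_le F s N h (1 / 2 ^ M))) sequentially"
        using eventually_ge_at_top
        by (intro eventually_conj eventually_cover_cost_le_near_lipschitz[OF s(2) g(1) _ g(4)]) auto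
      then obtain N where N: "M \<le> N"
        "\<And>h. (\<forall>x\<in>F. \<bar>g x - h x\<bar> \<le> 1 / 2 ^ N) \<Longrightarrow> cover_cost_le F s N h (1 / 2 ^ M)"
        using eventually_happens'[OF sequentially_bot] by blast
      have "cover_cost_le F s N h (1 / 2 ^ M)" if "h \<in> holder1 \<alpha> F" "mdist m g h < 1 / 2 ^ N" for h
        using that dist_le[OF g(2) that(1), of "1 / 2 ^ N"] by (intro N(2)) auto
      with N(1) g(2) have "mball g (1 / 2 ^ N) \<in> \<B> M" unfolding \<B>_def by blast
      moreover have "g \<in> mball g (1 / 2 ^ N)" using g(2) by (simp add: m[symmetric])
      moreover have "g \<in> mball f \<epsilon>"
      proof -
        have "g \<in> mspace m" using g(2) by (simp add: m)
        moreover have "mdist m f g \<le> \<epsilon> / 2"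
          using dist_le[of f g "\<epsilon> / 2"] g(2,3) f \<open>0 < \<epsilon>\<close> by (simp add: m)
        ultimately show ?thesis using f \<open>0 < \<epsilon>\<close> by simp
      qed
      ultimately show ?thesis by blast
    qed
    then show ?thesis by (auto simp: metric_closure_of)
  qed
  have "restrict (\<lambda>_. 0) F \<in> mspace m" by (auto simp: m holder1_def)
  then have "mspace m \<noteq> {}" by blast
  moreover have "mcomplete_of m" unfolding m_def by (rule mcomplete_holder1_metric)
  moreover have "openin (mtopology_of m) (\<Union>(\<B> M))" for M
    unfolding top \<B>_def by (intro openin_Union) auto
  moreover have "gdelta_in (mtopology_of m) G" "mtopology_of m closure_of G = mspace m"
    using G by (simp_all add: dense_gdeltas_def m_def)
  moreover have "mtopology_of m closure_of \<Union>(\<B> M) = mspace m" for M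
    unfolding top by (rule dense)
  ultimately obtain g where "g \<in> G" and g: "\<And>M. g \<in> \<Union>(\<B> M)"
    using dense_gdelta_meets_residual[of m G "\<lambda>M. \<Union>(\<B> M)"] by metis
  have "AE r in lborel. hausdorff_measure s {x \<in> F. g x = r} = 0"
    using AE_hausdorff_measure_level_set_eq_0[OF assms(3) s(1) cost[OF g]] .
  with \<open>g \<in> G\<close> show ?thesis by blast
qed

theorem theorem3p1:
  fixes F :: "(real ^ 'n) set" and \<alpha> :: real
  assumes "0 < \<alpha>" and "\<alpha> \<le> 1"
    and "bounded F" and "F \<in> sets lebesgue"
  shows "D_star \<alpha> F \<le> max 0 (upper_box_dim F - 1)"
proof (rule dense_ge)
  fix z assume "max 0 (upper_box_dim F - 1) < z"
  then obtain s where max_less: "max 0 (upper_box_dim F - 1) < ereal s" and "ereal s < z"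
    using ereal_dense2 by blast
  from max_less have "0 < ereal s" "upper_box_dim F - 1 < ereal s"
    unfolding max_less_iff_conj by blast+
  then have s: "0 < s" "upper_box_dim F < ereal (s + 1)"
    by (simp, cases "upper_box_dim F") (auto simp: one_ereal_def)
  have "(INF f\<in>G. D_star_fun f F) \<le> ereal s" if G: "G \<in> dense_gdeltas \<alpha> F" for G
  proof -
    obtain g where "g \<in> G" "AE r in lborel. hausdorff_measure s {x \<in> F. g x = r} = 0"
      using dense_gdelta_contains_null_levels[OF assms(1-3) s G] by blast
    with s(1) show ?thesis by (intro INF_lower2 D_star_fun_le) auto
  qed
  then have "D_star \<alpha> F \<le> ereal s" unfolding D_star_def by (rule SUP_least)
  with \<open>ereal s < z\<close> show "D_star \<alpha> F \<le> z" by simp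
qed

end
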